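(* Let $\{x^k\}_{k\ge0}$ be generated by the Randomized Block Coordinate Descent method (RBCD) of the context with parameter $\alpha\in[0,1]$, where $f:\mathbb{R}^d\to\mathbb{R}$ is continuously differentiable, attains its minimum $f^*$, and is Hölder smooth and block Hölder smooth with exponent $\gamma\in(0,1]$. With $\nu=\frac{1+\gamma}{\gamma}$, for all $k\ge0$, $$\min_{0\le j\le k}\mathbb{E}\left[\|\nabla f(x^j)\|_{1+\alpha-\nu,\nu}\right]\le\left(\nu S_\alpha(f)\right)^{\frac1\nu}\left(\frac{f(x^0)-f^*}{k+1}\right)^{\frac1\nu}=\mathcal{O}\left(k^{-\frac1\nu}\right).$$ Consequently, measured in the norm $\|\cdot\|_{\beta,2}$ ($\beta\in\mathbb{R}$), for all $k\ge0$, $$\min_{0\le j\le k}\mathbb{E}\left[\|\nabla f(x^j)\|_{\beta,2}\right]\le\left(\frac{\max_{1\le i\le m}L_i^{\frac\beta2-\frac{1+\alpha-\nu}{\nu}}}{m^{\frac{\nu-2}{2\nu}}}\right)\left(\nu S_\alpha(f)\right)^{\frac1\nu}\left(\frac{f(x^0)-f^*}{k+1}\right)^{\frac1\nu}=\mathcal{O}\left(k^{-\frac1\nu}\right).$$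
   Context: $P_1,\dots,P_m\in\mathbb{R}^{d\times d}$ are orthogonal projection matrices onto mutually orthogonal subspaces that sum to $\mathbb{R}^d$; $\nabla_if(x)=P_i\nabla f(x)$; $\|\cdot\|$ is the Euclidean norm. Hölder smooth: there is $L>0$ with $\|\nabla f(y)-\nabla f(x)\|\le L\|y-x\|^\gamma$ for all $x,y$. Block Hölder smooth: for each $i$ there is $L_i>0$ with $\|\nabla f(x+P_iu)-\nabla f(x)\|\le L_i\|P_iu\|^\gamma$ for all $x,u\in\mathbb{R}^d$. $S_\alpha(f)=\sum_{i=1}^mL_i^\alpha$. For $a\in\mathbb{R}$, $q\ge1$: $\|x\|_{a,q}=\left(\sum_{i=1}^mL_i^a\|P_ix\|^q\right)^{1/q}$. RBCD: given $x^0\in\mathbb{R}^d$ and $\alpha\in[0,1]$, for $k=0,1,2,\dots$ choose $i_k\in\{1,\dots,m\}$ at random (independently of the past) with probabilities $p_i=L_i^\alpha/\sum_jL_j^\alpha$, and set $x^{k+1}=x^k-\frac{\|\nabla_{i_k}f(x^k)\|^{\nu-2}}{L_{i_k}^{\nu-1}}\nabla_{i_k}f(x^k)$.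
   Formalization: In the second bound the factor m^((ν-2)/(2ν)) multiplies instead of dividing: the printed bound is false (e.g. d=m=64, coordinate blocks, f=-cos(∑x_i), γ=1/5, α=β=0, L_i=16, ∑x^0_i=π/2, k=0); the two versions agree when γ=1 or m=1. *)

theory Defs
  imports "HOL-Probability.Probability" "HOL-Library.Landau_Symbols"
begin

text \<open>
  \<^term>\<open>gradient f x\<close> is only meaningful where \<open>f\<close> is differentiable.
\<close>

definition gradient :: "('a::real_inner \<Rightarrow> real) \<Rightarrow> 'a \<Rightarrow> 'a" where
  "gradient f x = (THE D. GDERIV f x :> D)"

definition continuously_differentiable :: "('a::real_inner \<Rightarrow> real) \<Rightarrow> bool" where
  "continuously_differentiable f \<longleftrightarrow>
     (\<forall>x. \<exists>D. GDERIV f x :> D) \<and> continuous_on UNIV (gradient f)"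

definition orthogonal_projection_onto :: "real ^ 'd ^ 'd \<Rightarrow> (real ^ 'd) set \<Rightarrow> bool" where
  "orthogonal_projection_onto Q E \<longleftrightarrow>
     subspace E \<and> (\<forall>x. Q *v x \<in> E \<and> (\<forall>y\<in>E. orthogonal (x - Q *v x) y))"

text \<open>
  The \<open>m\<close> blocks are indexed by a finite type, so \<open>m\<close> is its cardinality.
\<close>

definition block_projections :: "('m::finite \<Rightarrow> real ^ 'd ^ 'd) \<Rightarrow> bool" where
  "block_projections P \<longleftrightarrow>
     (\<exists>E. (\<forall>i. orthogonal_projection_onto (P i) (E i)) \<and>
          (\<forall>i j. i \<noteq> j \<longrightarrow> (\<forall>x\<in>E i. \<forall>y\<in>E j. orthogonal x y)) \<and>
          (\<forall>x. \<exists>y. (\<forall>i. y i \<in> E i) \<and> x = (\<Sum>i\<in>UNIV. y i)))"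

definition block_gradient ::
    "('m \<Rightarrow> real ^ 'd ^ 'd) \<Rightarrow> (real ^ 'd \<Rightarrow> real) \<Rightarrow> 'm \<Rightarrow> real ^ 'd \<Rightarrow> real ^ 'd" where
  "block_gradient P f i x = P i *v gradient f x"

definition holder_smooth :: "real \<Rightarrow> (real ^ 'd \<Rightarrow> real) \<Rightarrow> bool" where
  "holder_smooth \<gamma> f \<longleftrightarrow>
     (\<exists>L>0. \<forall>x y. norm (gradient f y - gradient f x) \<le> L * norm (y - x) powr \<gamma>)"

text \<open>
  The left-hand side involves the full gradient, not only its \<open>i\<close>-th block.
\<close>

definition block_holder_smooth ::
    "('m \<Rightarrow> real ^ 'd ^ 'd) \<Rightarrow> real \<Rightarrow> ('m \<Rightarrow> real) \<Rightarrow> (real ^ 'd \<Rightarrow> real) \<Rightarrow> bool" where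
  "block_holder_smooth P \<gamma> L f \<longleftrightarrow>
     (\<forall>i. L i > 0 \<and>
          (\<forall>x u. norm (gradient f (x + P i *v u) - gradient f x)
                   \<le> L i * norm (P i *v u) powr \<gamma>))"

definition holder_sum :: "('m::finite \<Rightarrow> real) \<Rightarrow> real \<Rightarrow> real" where
  "holder_sum L \<alpha> = (\<Sum>i\<in>UNIV. L i powr \<alpha>)"

definition block_norm ::
    "('m::finite \<Rightarrow> real ^ 'd ^ 'd) \<Rightarrow> ('m \<Rightarrow> real) \<Rightarrow> real \<Rightarrow> real \<Rightarrow> real ^ 'd \<Rightarrow> real" where
  "block_norm P L a q x = (\<Sum>i\<in>UNIV. L i powr a * norm (P i *v x) powr q) powr (1 / q)"

definition rbcd_step ::
    "('m \<Rightarrow> real ^ 'd ^ 'd) \<Rightarrow> ('m \<Rightarrow> real) \<Rightarrow> real \<Rightarrow> (real ^ 'd \<Rightarrow> real) \<Rightarrow> 'm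
       \<Rightarrow> real ^ 'd \<Rightarrow> real ^ 'd" where
  "rbcd_step P L \<nu> f i x =
     x - (norm (block_gradient P f i x) powr (\<nu> - 2) / L i powr (\<nu> - 1)) *\<^sub>R
           block_gradient P f i x"

text \<open>
  \<open>I k\<close> is the random index and \<open>X k\<close> the random iterate at step \<open>k\<close>, both on the probability
  space \<open>M\<close>. When the block gradient vanishes, the step length is irrelevant, so the value
  \<^term>\<open>(0::real) powr 0 = 0\<close> is harmless.
\<close>

definition rbcd ::
    "'w measure \<Rightarrow> ('m::finite \<Rightarrow> real ^ 'd ^ 'd) \<Rightarrow> ('m \<Rightarrow> real) \<Rightarrow> real \<Rightarrow> real
       \<Rightarrow> (real ^ 'd \<Rightarrow> real) \<Rightarrow> real ^ 'd \<Rightarrow> (nat \<Rightarrow> 'w \<Rightarrow> 'm) \<Rightarrow> (nat \<Rightarrow> 'w \<Rightarrow> real ^ 'd) \<Rightarrow> bool" where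
  "rbcd M P L \<alpha> \<nu> f x0 I X \<longleftrightarrow>
     prob_space M \<and>
     prob_space.indep_vars M (\<lambda>_. count_space UNIV) I UNIV \<and>
     (\<forall>k i. measure M {\<omega> \<in> space M. I k \<omega> = i} = L i powr \<alpha> / holder_sum L \<alpha>) \<and>
     (\<forall>\<omega>\<in>space M. X 0 \<omega> = x0 \<and>
        (\<forall>k. X (Suc k) \<omega> = rbcd_step P L \<nu> f (I k \<omega>) (X k \<omega>)))"

end

theory Submission
  imports Defs
begin

text \<open>
  Integrating the block Hoelder bound along a block gives an upper model of order \<open>1 + \<gamma>\<close>.
  The RBCD step minimises this model along the block gradient, so updating block \<open>i\<close> lowers \<open>f\<close>
  by at least \<open>norm (block_gradient P f i x) powr \<nu> / (\<nu> * L i powr (\<nu> - 1))\<close>. Averaging over the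
  sampling probabilities \<open>L i powr \<alpha> / holder_sum L \<alpha>\<close> turns the exponent of \<open>L i\<close> into
  \<open>1 + \<alpha> - \<nu>\<close>, so the expected decrease is the \<open>\<nu>\<close>-th power of the block norm of the gradient
  divided by \<open>\<nu> * holder_sum L \<alpha>\<close>. Telescoping and Jensen's inequality for \<open>t powr \<nu>\<close> give the
  first rate; the power mean inequality compares the two block norms.
\<close>

section \<open>Convexity inequalities for real powers\<close>

text \<open>The graph of \<open>t powr p\<close> lies above its tangent at \<open>c\<close>, written
  without subtraction. This is Young's inequality with conjugate exponent
  \<open>p / (p - 1)\<close>, so \<open>p = 1\<close> is treated apart. Summed or integrated with
  \<open>c\<close> a mean, it yields Jensen's inequality.\<close>

lemma powr_tangent:
  fixes p c y :: real
  assumes "p \<ge> 1" "c \<ge> 0" "y \<ge> 0"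
  shows "p * c powr (p - 1) * y \<le> y powr p + (p - 1) * c powr p"
proof (cases "p = 1")
  case True
  then show ?thesis using assms by auto
next
  case False
  define q where "q = p / (p - 1)"
  have p: "p > 1" using False assms by auto
  then have q: "q > 1" "1/p + 1/q = 1" by (auto simp: q_def field_simps)
  have "y * c powr (p - 1) \<le> y powr p / p + (c powr (p - 1)) powr q / q"
    using p q assms by (intro Youngs_inequality) auto
  also have "(c powr (p - 1)) powr q = c powr p"
    using p by (simp add: powr_powr q_def)
  finally have "p * (y * c powr (p - 1)) \<le> p * (y powr p / p + c powr p / q)"
    using p by (intro mult_left_mono) auto
  also have "\<dots> = y powr p + (p - 1) * c powr p"
    using p by (simp add: q_def field_simps)
  finally show ?thesis by (simp add: mult_ac)
qed

text \<open>Jensen's inequality: the tangent inequality is integrated with \<open>c\<close> equal to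
  the mean, where the linear term becomes \<open>p * c powr p\<close>.\<close>

lemma (in prob_space) expectation_powr_le:
  fixes Y :: "'a \<Rightarrow> real"
  assumes "p \<ge> 1" "\<And>\<omega>. \<omega> \<in> space M \<Longrightarrow> Y \<omega> \<ge> 0"
    and "integrable M Y" "integrable M (\<lambda>\<omega>. Y \<omega> powr p)"
  shows "expectation Y powr p \<le> expectation (\<lambda>\<omega>. Y \<omega> powr p)"
proof -
  define c where "c = expectation Y"
  have c: "c \<ge> 0" unfolding c_def using assms(2) by (intro integral_nonneg_AE) auto
  have "expectation (\<lambda>\<omega>. p * c powr (p - 1) * Y \<omega>)
      \<le> expectation (\<lambda>\<omega>. Y \<omega> powr p + (p - 1) * c powr p)"
    using assms c by (intro integral_mono powr_tangent) auto
  also have "\<dots> = expectation (\<lambda>\<omega>. Y \<omega> powr p) + (p - 1) * c powr p"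
    using assms by (simp add: prob_space)
  also have "expectation (\<lambda>\<omega>. p * c powr (p - 1) * Y \<omega>) = p * c powr (p - 1) * c"
    using assms by (simp add: c_def)
  also have "\<dots> = p * c powr p"
    using c by (cases "c = 0") (auto simp: powr_diff)
  finally show ?thesis by (simp add: c_def algebra_simps)
qed

text \<open>The discrete counterpart: the tangent inequalities at the average
  \<open>c = s / n\<close> are summed, and \<open>s = n * c\<close> supplies the power of the
  cardinality.\<close>

lemma sum_powr_mean_le:
  fixes b :: "'i \<Rightarrow> real"
  assumes "finite A" "p \<ge> 1" "\<And>i. i \<in> A \<Longrightarrow> b i \<ge> 0"
  shows "(\<Sum>i\<in>A. b i) powr p \<le> real (card A) powr (p - 1) * (\<Sum>i\<in>A. b i powr p)"
proof (cases "A = {}")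
  case False
  define n where "n = real (card A)"
  have n: "n > 0" using False assms by (simp add: n_def card_gt_0_iff)
  define s where "s = (\<Sum>i\<in>A. b i)"
  have s: "s \<ge> 0" unfolding s_def using assms by (intro sum_nonneg)
  define c where "c = s / n"
  have c: "c \<ge> 0" using s n by (simp add: c_def)
  have "(\<Sum>i\<in>A. p * c powr (p - 1) * b i) \<le> (\<Sum>i\<in>A. b i powr p + (p - 1) * c powr p)"
    using assms c by (intro sum_mono powr_tangent) auto
  also have "\<dots> = (\<Sum>i\<in>A. b i powr p) + n * ((p - 1) * c powr p)"
    by (simp add: sum.distrib n_def)
  also have "(\<Sum>i\<in>A. p * c powr (p - 1) * b i) = p * c powr (p - 1) * (n * c)"
    using n by (simp add: sum_distrib_left[symmetric] c_def s_def)
  also have "\<dots> = n * (p * c powr p)"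
    using c by (cases "c = 0") (auto simp: powr_diff)
  finally have *: "n * c powr p \<le> (\<Sum>i\<in>A. b i powr p)"
    by (simp add: algebra_simps)
  have "s powr p = n powr (p - 1) * (n * c powr p)"
    using n s by (simp add: c_def powr_divide powr_diff)
  also have "\<dots> \<le> n powr (p - 1) * (\<Sum>i\<in>A. b i powr p)"
    using * by (intro mult_left_mono) auto
  finally show ?thesis by (simp add: s_def n_def)
qed (use assms in auto)

text \<open>The power mean inequality with exponent \<open>p / 2\<close> for the squares, followed
  by a \<open>p\<close>-th root. For equal entries both sides agree, so the power of the cardinality
  has to stand as a factor.\<close>

lemma L2_sum_le_Lp_sum:
  fixes a :: "'i \<Rightarrow> real"
  assumes "finite A" "p \<ge> 2" "\<And>i. i \<in> A \<Longrightarrow> a i \<ge> 0"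
  shows "(\<Sum>i\<in>A. a i powr 2) powr (1 / 2)
    \<le> real (card A) powr ((p - 2) / (2 * p)) * (\<Sum>i\<in>A. a i powr p) powr (1 / p)"
proof -
  let ?S = "\<Sum>i\<in>A. a i powr 2"
  have S: "?S \<ge> 0" by (intro sum_nonneg) auto
  have "?S powr (p / 2) \<le> real (card A) powr (p / 2 - 1) * (\<Sum>i\<in>A. (a i powr 2) powr (p / 2))"
    using assms by (intro sum_powr_mean_le) auto
  then have "?S powr (p / 2) \<le> real (card A) powr (p / 2 - 1) * (\<Sum>i\<in>A. a i powr p)"
    by (simp add: powr_powr)
  then have "(?S powr (p / 2)) powr (1 / p)
      \<le> (real (card A) powr (p / 2 - 1) * (\<Sum>i\<in>A. a i powr p)) powr (1 / p)"
    using assms by (intro powr_mono2) auto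
  also have "\<dots> = real (card A) powr ((p / 2 - 1) * (1 / p)) * (\<Sum>i\<in>A. a i powr p) powr (1 / p)"
    by (simp add: powr_mult powr_powr sum_nonneg)
  also have "(p / 2 - 1) * (1 / p) = (p - 2) / (2 * p)"
    using assms by (simp add: field_simps)
  also have "(?S powr (p / 2)) powr (1 / p) = ?S powr (1 / 2)"
    using assms by (simp add: powr_powr)
  finally show ?thesis .
qed

section \<open>Gradients and the decrease achieved by one block step\<close>

text \<open>The description defining \<open>gradient\<close> has only one solution: two candidates
  induce the same linear functional, and evaluating it at their difference shows that they
  coincide.\<close>

lemma GDERIV_gradient:
  assumes "continuously_differentiable f"
  shows "GDERIV f x :> gradient f x"
proof -
  obtain D where D: "GDERIV f x :> D"
    using assms by (auto simp: continuously_differentiable_def)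
  have "D' = D" if "GDERIV f x :> D'" for D'
  proof -
    have "(\<lambda>h. inner h D') = (\<lambda>h. inner h D)"
      using that D has_derivative_unique unfolding gderiv_def by blast
    then have "inner (D' - D) (D' - D) = 0"
      by (metis inner_diff_right right_minus_eq)
    then show ?thesis by simp
  qed
  with D show ?thesis
    unfolding gradient_def by (metis theI)
qed

text \<open>The bound is assumed along one ray only, so that it can be supplied for block
  directions. Instead of an integral, the proof uses that \<open>\<phi>\<close>, up to the constant
  \<open>f x\<close> the gap between \<open>f\<close> on the segment and its model of order
  \<open>1 + \<gamma>\<close>, is nonincreasing.\<close>

lemma holder_descent:
  fixes f :: "'a::real_inner \<Rightarrow> real"
  assumes f: "continuously_differentiable f" and g: "\<gamma> > 0"
    and hol: "\<And>s. s \<ge> 0 \<Longrightarrow>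
      norm (gradient f (x + s *\<^sub>R h) - gradient f x) \<le> L * norm (s *\<^sub>R h) powr \<gamma>"
  shows "f (x + h) \<le> f x + inner (gradient f x) h + L / (1 + \<gamma>) * norm h powr (1 + \<gamma>)"
proof -
  define \<phi> where "\<phi> s = f (x + s *\<^sub>R h) - s * inner (gradient f x) h
     - L / (1 + \<gamma>) * norm h powr (1 + \<gamma>) * s powr (1 + \<gamma>)" for s :: real
  have df: "((\<lambda>s. f (x + s *\<^sub>R h)) has_real_derivative inner h (gradient f (x + s *\<^sub>R h))) (at s)"
    for s
  proof -
    have "((\<lambda>s. x + s *\<^sub>R h) has_derivative (\<lambda>t. t *\<^sub>R h)) (at s)"
      by (auto intro!: derivative_eq_intros)
    moreover have "(f has_derivative (\<lambda>k. inner k (gradient f (x + s *\<^sub>R h)))) (at (x + s *\<^sub>R h))"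
      using GDERIV_gradient[OF f] by (simp add: gderiv_def)
    ultimately have "((\<lambda>s. f (x + s *\<^sub>R h)) has_derivative
        (\<lambda>t. inner (t *\<^sub>R h) (gradient f (x + s *\<^sub>R h)))) (at s)"
      by (rule has_derivative_compose)
    moreover have "(\<lambda>t. inner (t *\<^sub>R h) (gradient f (x + s *\<^sub>R h)))
        = (*) (inner h (gradient f (x + s *\<^sub>R h)))"
      by (simp add: fun_eq_iff)
    ultimately show ?thesis
      by (simp only: has_field_derivative_def)
  qed
  have "\<phi> 1 \<le> \<phi> 0"
  \<comment> \<open>The sign of the derivative is needed only inside the interval, where
    \<open>s > 0\<close> lets \<open>s powr (1 + \<gamma>)\<close> be differentiated; continuity
    covers the end points.\<close>
  proof (rule DERIV_nonpos_imp_decreasing_open[where f = \<phi> and a = 0 and b = 1])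
    fix s :: real assume s: "0 < s" "s < 1"
    let ?d = "inner h (gradient f (x + s *\<^sub>R h)) - inner (gradient f x) h
      - L * norm h powr (1 + \<gamma>) * s powr \<gamma>"
    have "((\<lambda>s. s powr (1 + \<gamma>)) has_real_derivative (1 + \<gamma>) * s powr \<gamma>) (at s)"
      using has_real_derivative_powr[of s "1 + \<gamma>"] s by simp
    then have "((\<lambda>s. L / (1 + \<gamma>) * norm h powr (1 + \<gamma>) * s powr (1 + \<gamma>)) has_real_derivative
        L / (1 + \<gamma>) * norm h powr (1 + \<gamma>) * ((1 + \<gamma>) * s powr \<gamma>)) (at s)"
      by (rule DERIV_cmult)
    also have "L / (1 + \<gamma>) * norm h powr (1 + \<gamma>) * ((1 + \<gamma>) * s powr \<gamma>)
        = L * norm h powr (1 + \<gamma>) * s powr \<gamma>"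
      using g by simp
    finally have "(\<phi> has_real_derivative ?d) (at s)"
      unfolding \<phi>_def[abs_def]
      by (intro DERIV_diff df) (auto intro!: derivative_eq_intros)
    moreover have "?d \<le> 0"
    proof -
      have "inner h (gradient f (x + s *\<^sub>R h)) - inner (gradient f x) h
          = inner h (gradient f (x + s *\<^sub>R h) - gradient f x)"
        by (simp add: inner_diff_right inner_commute)
      also have "\<dots> \<le> norm h * norm (gradient f (x + s *\<^sub>R h) - gradient f x)"
        by (rule norm_cauchy_schwarz)
      also have "\<dots> \<le> norm h * (L * norm (s *\<^sub>R h) powr \<gamma>)"
        using s by (intro mult_left_mono hol) auto
      also have "\<dots> = L * norm h powr (1 + \<gamma>) * s powr \<gamma>"
        using s by (simp add: powr_mult powr_add)
      finally show ?thesis by simp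
    qed
    ultimately show "\<exists>y. (\<phi> has_real_derivative y) (at s) \<and> y \<le> 0" by blast
  next
    have "continuous_on {0..1} (\<lambda>s. f (x + s *\<^sub>R h))"
      by (intro continuous_at_imp_continuous_on ballI DERIV_isCont[OF df])
    then show "continuous_on {0..1} \<phi>"
      unfolding \<phi>_def[abs_def] using g
      by (intro continuous_on_diff continuous_on_mult continuous_on_powr' continuous_on_const
          continuous_on_id) auto
  qed simp
  then show ?thesis by (simp add: \<phi>_def)
qed

text \<open>The residual \<open>x - P i *v x\<close> is orthogonal to the subspace that contains
  \<open>P i *v x\<close>.\<close>

lemma inner_block_projection:
  assumes "block_projections P"
  shows "inner x (P i *v x) = (norm (P i *v x))\<^sup>2"
proof -
  obtain E where "orthogonal_projection_onto (P i) E"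
    using assms by (auto simp: block_projections_def)
  then have "inner (x - P i *v x) (P i *v x) = 0"
    by (auto simp: orthogonal_projection_onto_def orthogonal_def)
  then show ?thesis
    by (simp add: inner_diff_left power2_norm_eq_inner)
qed

text \<open>For a block gradient of norm \<open>n > 0\<close>, step length \<open>t\<close> changes
  the model by \<open>- t * n powr 2 + L i / (1 + \<gamma>) * (t * n) powr (1 + \<gamma>)\<close>.
  The minimiser satisfies \<open>t * n = (n / L i) powr (\<nu> - 1)\<close>, because
  \<open>\<nu> - 1 = 1 / \<gamma>\<close>.\<close>

lemma rbcd_step_descent:
  fixes P :: "'m::finite \<Rightarrow> real ^ 'd ^ 'd"
  assumes P: "block_projections P" and f: "continuously_differentiable f"
    and g: "0 < \<gamma>" and hol: "block_holder_smooth P \<gamma> L f" and nu: "\<nu> = (1 + \<gamma>) / \<gamma>"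
  shows "f (rbcd_step P L \<nu> f i x)
    \<le> f x - norm (block_gradient P f i x) powr \<nu> / (\<nu> * L i powr (\<nu> - 1))"
proof -
  have Li: "L i > 0" using hol by (auto simp: block_holder_smooth_def)
  define G where "G = block_gradient P f i x"
  define n where "n = norm G"
  define t where "t = n powr (\<nu> - 2) / L i powr (\<nu> - 1)"
  \<comment> \<open>Written as an image under \<open>P i\<close>, so that every multiple
    \<open>s *\<^sub>R h\<close> is again a block displacement, as the block Hoelder bound
    requires.\<close>
  define h where "h = P i *v ((- t) *\<^sub>R gradient f x)"
  have hG: "h = (- t) *\<^sub>R G"
    unfolding h_def G_def block_gradient_def by (rule matrix_vector_mult_scaleR)
  have t0: "t \<ge> 0" by (simp add: t_def)
  have n0: "n \<ge> 0" by (simp add: n_def)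
  have step: "rbcd_step P L \<nu> f i x = x + h"
    by (simp add: rbcd_step_def hG t_def G_def n_def)
  show ?thesis
  proof (cases "n = 0")
    case True
    \<comment> \<open>A vanishing block gradient leaves \<open>x\<close> in place, and the claimed
      decrease is zero since \<open>0 powr \<nu> = 0\<close>.\<close>
    then show ?thesis using hG by (simp add: step n_def flip: G_def)
  next
    case False
    then have n: "n > 0" using n0 by auto
    have "f (x + h) \<le> f x + inner (gradient f x) h + L i / (1 + \<gamma>) * norm h powr (1 + \<gamma>)"
    proof (rule holder_descent[OF f g])
      fix s :: real
      have "s *\<^sub>R h = P i *v (s *\<^sub>R ((- t) *\<^sub>R gradient f x))"
        unfolding h_def by (simp only: matrix_vector_mult_scaleR)
      then show "norm (gradient f (x + s *\<^sub>R h) - gradient f x) \<le> L i * norm (s *\<^sub>R h) powr \<gamma>"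
        using hol unfolding block_holder_smooth_def by metis
    qed
    also have "inner (gradient f x) h = - (n powr \<nu> / L i powr (\<nu> - 1))"
    proof -
      have "inner (gradient f x) h = - t * n\<^sup>2"
        using inner_block_projection[OF P, of "gradient f x" i]
        by (simp add: hG n_def G_def block_gradient_def)
      also have "n\<^sup>2 = n powr 2" using n by simp
      also have "- t * n powr 2 = - (n powr \<nu> / L i powr (\<nu> - 1))"
        using n by (simp add: t_def del: powr_numeral flip: powr_add)
      finally show ?thesis .
    qed
    also have "L i / (1 + \<gamma>) * norm h powr (1 + \<gamma>) = n powr \<nu> / L i powr (\<nu> - 1) / (1 + \<gamma>)"
    proof -
      have "norm h = t * n" using t0 by (simp add: hG n_def)
      also have "t * n = n powr (\<nu> - 1) / L i powr (\<nu> - 1)"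
        using n powr_add[of n "\<nu> - 2" 1] by (simp add: t_def)
      finally have "norm h powr (1 + \<gamma>) = n powr ((\<nu> - 1) * (1 + \<gamma>)) / L i powr ((\<nu> - 1) * (1 + \<gamma>))"
        using n Li by (simp add: powr_divide powr_powr)
      also have "(\<nu> - 1) * (1 + \<gamma>) = \<nu>"
        using g by (simp add: nu field_simps)
      finally show ?thesis
        using Li by (simp add: powr_diff mult_ac)
    qed
    finally have "f (x + h) \<le> f x - n powr \<nu> / L i powr (\<nu> - 1) * (1 - 1 / (1 + \<gamma>))"
      by (simp add: right_diff_distrib)
    \<comment> \<open>The Hoelder remainder costs the fraction \<open>1 / (1 + \<gamma>)\<close> of
      the linear gain; the fraction \<open>\<gamma> / (1 + \<gamma>)\<close> is left.\<close>
    also have "1 - 1 / (1 + \<gamma>) = 1 / \<nu>"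
      using g by (simp add: nu field_simps)
    finally show ?thesis by (simp add: step n_def G_def mult.commute)
  qed
qed

section \<open>Comparison of weighted block norms\<close>

lemma block_norm_powr:
  assumes "q \<ge> 1"
  shows "block_norm P L a q x powr q = (\<Sum>i\<in>UNIV. L i powr a * norm (P i *v x) powr q)"
  using assms by (simp add: block_norm_def powr_powr sum_nonneg)

text \<open>The weight splits as \<open>L i powr (b / 2) = w i * L i powr (a / q)\<close>. The
  factor \<open>w i\<close> is replaced by its maximum; what remains is the unweighted comparison of
  exponents \<open>2\<close> and \<open>q\<close> for the numbers \<open>c i\<close>.\<close>

lemma block_norm_le_block_norm:
  fixes P :: "'m::finite \<Rightarrow> real ^ 'd ^ 'd"
  assumes L: "\<And>i. L i > 0" and q: "q \<ge> 2"
  shows "block_norm P L b 2 x \<le> Max (range (\<lambda>i. L i powr (b / 2 - a / q)))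
    * real CARD('m) powr ((q - 2) / (2 * q)) * block_norm P L a q x"
proof -
  define w where "w i = L i powr (b / 2 - a / q)" for i
  define W where "W = Max (range w)"
  have wW: "w i \<le> W" for i unfolding W_def by (intro Max_ge) auto
  have w0: "w i \<ge> 0" for i by (simp add: w_def)
  then have W0: "W \<ge> 0" using wW order_trans by blast
  define c where "c i = L i powr (a / q) * norm (P i *v x)" for i
  have c0: "c i \<ge> 0" for i by (simp add: c_def)
  have term2: "L i powr b * norm (P i *v x) powr 2 = w i powr 2 * c i powr 2" for i
  proof -
    have "w i powr 2 * c i powr 2 = (L i powr (b / 2)) powr 2 * norm (P i *v x) powr 2"
      using L[of i] by (simp add: w_def c_def powr_mult powr_diff powr_divide)
    then show ?thesis by (simp add: powr_powr)
  qed
  have termq: "L i powr a * norm (P i *v x) powr q = c i powr q" for i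
    using q by (simp add: c_def powr_mult powr_powr)
  have "block_norm P L b 2 x = (\<Sum>i\<in>UNIV. w i powr 2 * c i powr 2) powr (1 / 2)"
    by (simp only: block_norm_def term2)
  also have "\<dots> \<le> (\<Sum>i\<in>UNIV. W powr 2 * c i powr 2) powr (1 / 2)"
    using w0 wW by (intro powr_mono2 sum_mono mult_right_mono sum_nonneg) auto
  also have "\<dots> = W * (\<Sum>i\<in>UNIV. c i powr 2) powr (1 / 2)"
    using W0 by (simp add: sum_distrib_left[symmetric] powr_mult powr_powr sum_nonneg
        del: powr_numeral)
  also have "\<dots> \<le> W * (real CARD('m) powr ((q - 2) / (2 * q))
      * (\<Sum>i\<in>UNIV. c i powr q) powr (1 / q))"
    using q c0 W0 by (intro mult_left_mono L2_sum_le_Lp_sum) auto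
  also have "(\<Sum>i\<in>UNIV. c i powr q) powr (1 / q) = block_norm P L a q x"
    by (simp only: block_norm_def termq)
  finally show ?thesis by (simp add: W_def w_def mult.assoc)
qed

section \<open>Integrability and independence of the iterates\<close>

text \<open>Finitely many values make the composition bounded, whatever the growth of
  \<open>g\<close>. This supplies integrability of functions of the iterates.\<close>

lemma (in prob_space) integrable_finite_range_compose:
  fixes g :: "'b::topological_space \<Rightarrow> real"
  assumes "random_variable borel Y" "finite (Y ` space M)" "g \<in> borel_measurable borel"
  shows "integrable M (\<lambda>\<omega>. g (Y \<omega>))"
proof (rule integrable_const_bound)
  show "AE \<omega> in M. norm (g (Y \<omega>)) \<le> Max ((\<lambda>y. norm (g y)) ` Y ` space M)"
    using assms by (intro AE_I2 Max_ge) auto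
qed (use assms in measurable)

text \<open>Each step multiplies the number of possible states by at most the number of
  indices.\<close>

lemma (in prob_space) finite_range_random_recursion:
  fixes J :: "nat \<Rightarrow> 'a \<Rightarrow> 'i::finite"
  assumes "\<And>\<omega>. \<omega> \<in> space M \<Longrightarrow> X 0 \<omega> = x0"
    and step: "\<And>k \<omega>. \<omega> \<in> space M \<Longrightarrow> X (Suc k) \<omega> = T (J k \<omega>) (X k \<omega>)"
  shows "finite (X k ` space M)"
proof (induction k)
  case 0
  have "X 0 ` space M \<subseteq> {x0}" using assms(1) by auto
  then show ?case by (rule finite_subset) simp
next
  case (Suc k)
  have "X (Suc k) ` space M \<subseteq> (\<lambda>(i, x). T i x) ` (UNIV \<times> X k ` space M)"
    using step by force
  then show ?case by (rule finite_subset) (use Suc in auto)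
qed

text \<open>
  \<^const>\<open>prob_space.indep_var\<close> relates random variables of equal type only, so the state and the
  index are compared through real-valued functions of them.
\<close>

lemma (in prob_space) random_recursion:
  fixes J :: "nat \<Rightarrow> 'a \<Rightarrow> 'i::finite" and X :: "nat \<Rightarrow> 'a \<Rightarrow> 'b::topological_space"
  assumes ind: "indep_vars (\<lambda>_. count_space UNIV) J UNIV"
    and init: "\<And>\<omega>. \<omega> \<in> space M \<Longrightarrow> X 0 \<omega> = x0"
    and step: "\<And>k \<omega>. \<omega> \<in> space M \<Longrightarrow> X (Suc k) \<omega> = T (J k \<omega>) (X k \<omega>)"
    and T: "\<And>i. T i \<in> borel_measurable borel"
  shows random_variable_random_recursion: "random_variable borel (X k)"
    and indep_var_random_recursion:
      "(g :: 'b \<Rightarrow> real) \<in> borel_measurable borel \<Longrightarrow>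
        indep_var borel (\<lambda>\<omega>. g (X k \<omega>)) borel (\<lambda>\<omega>. indicator {i} (J k \<omega>))"
proof -
  \<comment> \<open>\<open>F k\<close> expresses the state as a deterministic function of the index
    history, reading only entries below \<open>k\<close>.\<close>
  define F where "F = rec_nat (\<lambda>h. x0) (\<lambda>k Fk (h :: nat \<Rightarrow> 'i). T (h k) (Fk h))"
  have F0: "F 0 h = x0" and FS: "F (Suc k) h = T (h k) (F k h)" for k h
    by (simp_all add: F_def)
  let ?C = "\<lambda>A. Pi\<^sub>M A (\<lambda>_. count_space UNIV)"
  let ?h = "\<lambda>\<omega>. \<lambda>j\<in>{..<k}. J j \<omega>"
  \<comment> \<open>\<open>A\<close> stays arbitrary because the induction step needs
    \<open>F k\<close> on a product that also contains coordinate \<open>k\<close>.\<close>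
  have meas: "{..<k} \<subseteq> A \<Longrightarrow> F k \<in> borel_measurable (?C A)" for k A
  proof (induction k)
    case 0
    have "F 0 = (\<lambda>_. x0)" by (rule ext) (simp add: F0)
    then show ?case by simp
  next
    case (Suc k)
    have [measurable]: "F k \<in> borel_measurable (?C A)"
      using Suc.prems by (intro Suc.IH) auto
    have "k \<in> A" using Suc.prems by auto
    then have "(\<lambda>h. h k) \<in> ?C A \<rightarrow>\<^sub>M count_space UNIV"
      by (rule measurable_component_singleton)
    \<comment> \<open>Measurability for each fixed index suffices, since the index takes countably
      many values.\<close>
    then have "(\<lambda>h. T (h k) (F k h)) \<in> borel_measurable (?C A)"
      by (rule measurable_compose_countable[rotated]) (use T in measurable)
    moreover have "F (Suc k) = (\<lambda>h. T (h k) (F k h))" by (rule ext) (rule FS)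
    ultimately show ?case by simp
  qed
  have XF: "X k \<omega> = F k h" if "\<omega> \<in> space M" "\<And>j. j < k \<Longrightarrow> h j = J j \<omega>" for k h \<omega>
    using that by (induction k) (simp_all add: F0 FS init step)
  have eq: "X k \<omega> = F k (?h \<omega>)" if "\<omega> \<in> space M" for \<omega>
    using XF[OF that, of k "?h \<omega>"] by simp
  \<comment> \<open>Disjoint sets of coordinates make the history before \<open>k\<close>
    independent of the index drawn at \<open>k\<close>.\<close>
  have "{..<k} \<inter> {k} = {}" by simp
  note ind' = indep_var_restrict[OF ind this subset_UNIV subset_UNIV]
  show "random_variable borel (X k)"
    using measurable_compose[OF indep_var_rv1[OF ind'] meas[OF order_refl]]
    by (subst measurable_cong[OF eq])
  assume g: "(g :: 'b \<Rightarrow> real) \<in> borel_measurable borel"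
  have "indep_var borel ((\<lambda>h. g (F k h)) \<circ> ?h) borel
      ((\<lambda>h. indicator {i} (h k)) \<circ> (\<lambda>\<omega>. \<lambda>j\<in>{k}. J j \<omega>))"
  proof (rule indep_var_compose[OF ind'])
    show "(\<lambda>h. g (F k h)) \<in> borel_measurable (?C {..<k})"
      by (rule measurable_compose[OF meas[OF order_refl] g])
    show "(\<lambda>h. indicator {i} (h k)) \<in> borel_measurable (?C {k})"
      by (rule measurable_compose[OF measurable_component_singleton]) auto
  qed
  then have *: "indep_var borel (\<lambda>\<omega>. g (F k (?h \<omega>))) borel (\<lambda>\<omega>. indicator {i} (J k \<omega>))"
    by (simp add: comp_def)
  \<comment> \<open>The two descriptions of the state agree only on \<open>space M\<close>, so
    independence is transferred through preimages cut down to \<open>space M\<close>.\<close>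
  have "{(\<lambda>\<omega>. g (F k (?h \<omega>))) -` A \<inter> space M | A. A \<in> sets borel}
      = {(\<lambda>\<omega>. g (X k \<omega>)) -` A \<inter> space M | A. A \<in> sets borel}"
    using eq by (intro Collect_cong ex_cong1 conj_cong refl) (auto simp: vimage_def)
  moreover have "(\<lambda>\<omega>. g (X k \<omega>)) \<in> borel_measurable M \<longleftrightarrow> (\<lambda>\<omega>. g (F k (?h \<omega>))) \<in> borel_measurable M"
    using eq by (intro measurable_cong) simp
  ultimately show "indep_var borel (\<lambda>\<omega>. g (X k \<omega>)) borel (\<lambda>\<omega>. indicator {i} (J k \<omega>))"
    using * unfolding indep_var_eq by simp
qed

text \<open>Takes the place of conditioning on \<open>Y\<close>: the integrand is split according to
  the value of \<open>J\<close> by indicators, and independence factors each summand.\<close>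

lemma (in prob_space) expectation_indep_selection:
  fixes g :: "'i::finite \<Rightarrow> 'b \<Rightarrow> real"
  assumes J: "random_variable (count_space UNIV) J"
    and int: "\<And>i. integrable M (\<lambda>\<omega>. g i (Y \<omega>))"
    and ind: "\<And>i. indep_var borel (\<lambda>\<omega>. g i (Y \<omega>)) borel (\<lambda>\<omega>. indicator {i} (J \<omega>))"
  shows "expectation (\<lambda>\<omega>. g (J \<omega>) (Y \<omega>))
    = (\<Sum>i\<in>UNIV. prob {\<omega> \<in> space M. J \<omega> = i} * expectation (\<lambda>\<omega>. g i (Y \<omega>)))"
proof -
  have set: "{\<omega> \<in> space M. J \<omega> = i} \<in> events" for i
    using J by measurable
  have int': "integrable M (\<lambda>\<omega>. indicator {i} (J \<omega>) :: real)" for i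
    using indep_var_rv2[OF ind[of i]]
    by (intro integrable_const_bound[where B=1]) (auto simp: indicator_def)
  have prob_eq: "expectation (\<lambda>\<omega>. indicator {i} (J \<omega>) :: real) = prob {\<omega> \<in> space M. J \<omega> = i}" for i
  proof -
    have "expectation (\<lambda>\<omega>. indicator {i} (J \<omega>) :: real)
        = expectation (\<lambda>\<omega>. indicator {\<omega> \<in> space M. J \<omega> = i} \<omega>)"
      by (intro Bochner_Integration.integral_cong) (auto simp: indicator_def)
    then show ?thesis using set[of i] by simp
  qed
  have "(\<Sum>i\<in>UNIV. g i (Y \<omega>) * indicator {i} (J \<omega>)) = g (J \<omega>) (Y \<omega>)" for \<omega>
    by (subst sum.remove[of _ "J \<omega>"]) (auto simp: indicator_def)
  then have "expectation (\<lambda>\<omega>. g (J \<omega>) (Y \<omega>))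
      = expectation (\<lambda>\<omega>. \<Sum>i\<in>UNIV. g i (Y \<omega>) * indicator {i} (J \<omega>))"
    by simp
  also have "\<dots> = (\<Sum>i\<in>UNIV. expectation (\<lambda>\<omega>. g i (Y \<omega>) * indicator {i} (J \<omega>)))"
    using indep_var_integrable[OF ind int int'] by (intro Bochner_Integration.integral_sum) auto
  also have "\<dots> = (\<Sum>i\<in>UNIV. expectation (\<lambda>\<omega>. g i (Y \<omega>)) * expectation (\<lambda>\<omega>. indicator {i} (J \<omega>)))"
    using indep_var_lebesgue_integral[OF ind int int'] by simp
  finally show ?thesis by (simp add: prob_eq mult.commute)
qed

section \<open>From a bound on a sum to a rate of decay\<close>

text \<open>Each of the \<open>k + 1\<close> summands is at least the \<open>p\<close>-th power of
  the minimum, so that power is at most the average.\<close>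

lemma min_le_of_sum_powr_le:
  fixes e :: "nat \<Rightarrow> real"
  assumes "p > 0" "\<And>j. e j \<ge> 0" and sum: "(\<Sum>j\<le>k. e j powr p) \<le> B"
  shows "Min (e ` {0..k}) \<le> (B / (real k + 1)) powr (1 / p)"
proof -
  define \<mu> where "\<mu> = Min (e ` {0..k})"
  have mu: "\<mu> \<le> e j" if "j \<le> k" for j
    unfolding \<mu>_def using that by (intro Min_le) auto
  have mu0: "\<mu> \<ge> 0" unfolding \<mu>_def using assms(2) by (subst Min_ge_iff) auto
  have "(\<Sum>j\<le>k. \<mu> powr p) \<le> (\<Sum>j\<le>k. e j powr p)"
    using mu mu0 assms(1) by (intro sum_mono powr_mono2) auto
  with sum have "\<mu> powr p \<le> B / (real k + 1)" by (simp add: field_simps)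
  then have "(\<mu> powr p) powr (1 / p) \<le> (B / (real k + 1)) powr (1 / p)"
    using assms(1) by (intro powr_mono2) auto
  then show ?thesis using assms(1) mu0 by (simp add: powr_powr \<mu>_def)
qed

lemma powr_decay_bigo:
  fixes C D a :: real
  assumes "a \<ge> 0" "D \<ge> 0"
  shows "(\<lambda>k::nat. C * (D / (real k + 1)) powr a) \<in> O(\<lambda>k. real k powr (- a))"
proof (rule bigoI[where c = "\<bar>C\<bar> * D powr a"])
  show "\<forall>\<^sub>F k::nat in sequentially.
      norm (C * (D / (real k + 1)) powr a) \<le> \<bar>C\<bar> * D powr a * norm (real k powr (- a))"
    \<comment> \<open>At \<open>k = 0\<close> the comparison sequence is \<open>0\<close> by the
      convention for \<open>0 powr\<close>, hence the restriction to \<open>k > 0\<close>.\<close>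
    using eventually_gt_at_top[of 0]
  proof eventually_elim
    case (elim k)
    have "(D / (real k + 1)) powr a \<le> (D / real k) powr a"
      using elim assms by (intro powr_mono2 divide_left_mono) auto
    also have "\<dots> = D powr a * real k powr (- a)"
      using assms by (simp add: powr_divide powr_minus field_simps)
    finally show ?case
      by (simp add: abs_mult mult.assoc mult_left_mono)
  qed
qed

section \<open>Borel measurability of the objective, the step and the gradient norms\<close>

lemma borel_measurable_of_continuously_differentiable:
  fixes f :: "'a::real_inner \<Rightarrow> real"
  assumes "continuously_differentiable f"
  shows "f \<in> borel_measurable borel"
  using GDERIV_gradient[OF assms]
  by (intro borel_measurable_continuous_onI continuous_at_imp_continuous_on)
    (auto simp: gderiv_def intro: has_derivative_continuous)

lemma continuous_on_gradient:
  "continuously_differentiable f \<Longrightarrow> continuous_on UNIV (gradient f)"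
  by (simp add: continuously_differentiable_def)

lemma borel_measurable_block_gradient:
  assumes "continuously_differentiable f"
  shows "block_gradient P f i \<in> borel_measurable borel"
  unfolding block_gradient_def[abs_def] using continuous_on_gradient[OF assms]
  by (intro borel_measurable_continuous_onI matrix_vector_mult_linear_continuous_on
      continuous_on_compose2[OF matrix_vector_mult_linear_continuous_on]) auto

lemma borel_measurable_rbcd_step:
  assumes "continuously_differentiable f"
  shows "rbcd_step P L \<nu> f i \<in> borel_measurable borel"
proof -
  note [measurable] = borel_measurable_block_gradient[OF assms]
  show ?thesis unfolding rbcd_step_def[abs_def] by measurable
qed

lemma borel_measurable_block_norm_gradient:
  assumes "continuously_differentiable f"
  shows "(\<lambda>x. block_norm P L a q (gradient f x)) \<in> borel_measurable borel"
proof -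
  note [measurable] = borel_measurable_block_gradient[OF assms]
  show ?thesis unfolding block_norm_def block_gradient_def[symmetric] by measurable
qed

section \<open>Expected decrease per iteration and the two rates\<close>

text \<open>The index drawn at step \<open>k\<close> is independent of \<open>X k\<close>, so the
  expected next value is the sampling average over deterministic block steps from
  \<open>X k\<close>, and the descent bound applies to each of them.\<close>

lemma rbcd_expected_descent:
  fixes P :: "'m::finite \<Rightarrow> real ^ 'd ^ 'd"
  assumes P: "block_projections P" and f: "continuously_differentiable f"
    and g: "0 < \<gamma>" and hol: "block_holder_smooth P \<gamma> L f" and nu: "\<nu> = (1 + \<gamma>) / \<gamma>"
    and rbcd: "rbcd M P L \<alpha> \<nu> f x0 I X"
  shows "(\<integral>\<omega>. f (X (Suc k) \<omega>) \<partial>M) \<le> (\<integral>\<omega>. f (X k \<omega>) \<partial>M)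
    - (\<integral>\<omega>. block_norm P L (1 + \<alpha> - \<nu>) \<nu> (gradient f (X k \<omega>)) powr \<nu> \<partial>M)
      / (\<nu> * holder_sum L \<alpha>)"
proof -
  interpret prob_space M using rbcd by (simp add: rbcd_def)
  have init: "\<And>\<omega>. \<omega> \<in> space M \<Longrightarrow> X 0 \<omega> = x0"
    and step: "\<And>k \<omega>. \<omega> \<in> space M \<Longrightarrow> X (Suc k) \<omega> = rbcd_step P L \<nu> f (I k \<omega>) (X k \<omega>)"
    and prob: "\<And>k i. prob {\<omega> \<in> space M. I k \<omega> = i} = L i powr \<alpha> / holder_sum L \<alpha>"
    and ind: "indep_vars (\<lambda>_. count_space UNIV) I UNIV"
    using rbcd by (auto simp: rbcd_def)
  have Lp: "L i > 0" for i using hol by (auto simp: block_holder_smooth_def)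
  have S: "holder_sum L \<alpha> > 0"
    unfolding holder_sum_def by (intro sum_pos) (auto simp: Lp[THEN less_imp_neq, symmetric])
  have nu1: "\<nu> > 1" using g by (simp add: nu field_simps)
  have fin: "finite (X k ` space M)"
    using init step by (rule finite_range_random_recursion)
  note Tm = borel_measurable_rbcd_step[OF f]
  note rv = random_variable_random_recursion[OF ind init step Tm]
  have J: "random_variable (count_space UNIV) (I k)"
    using ind by (auto simp: indep_vars_def)
  note fm = borel_measurable_of_continuously_differentiable[OF f]
  note bm [measurable] = borel_measurable_block_gradient[OF f] fm
  define D where "D i x = norm (block_gradient P f i x) powr \<nu>" for i x
  define c where "c i = 1 / (\<nu> * L i powr (\<nu> - 1))" for i
  have Dm [measurable]: "D i \<in> borel_measurable borel" for i
    unfolding D_def[abs_def] by measurable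
  have int_f: "integrable M (\<lambda>\<omega>. f (X k \<omega>))" and int_D: "\<And>i. integrable M (\<lambda>\<omega>. D i (X k \<omega>))"
    using integrable_finite_range_compose[OF rv fin] fm Dm by blast+
  have fs: "(\<lambda>x. f (rbcd_step P L \<nu> f i x)) \<in> borel_measurable borel" for i
    using measurable_compose[OF borel_measurable_rbcd_step[OF f] fm] .
  have sel: "indep_var borel (\<lambda>\<omega>. f (rbcd_step P L \<nu> f i (X k \<omega>))) borel
      (\<lambda>\<omega>. indicator {i} (I k \<omega>))" for i
    using ind init step Tm fs by (rule indep_var_random_recursion)
  have psum: "(\<Sum>i\<in>UNIV. L i powr \<alpha> / holder_sum L \<alpha>) = 1"
    using S by (simp add: holder_sum_def flip: sum_divide_distrib)
  have "expectation (\<lambda>\<omega>. f (X (Suc k) \<omega>))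
      = expectation (\<lambda>\<omega>. f (rbcd_step P L \<nu> f (I k \<omega>) (X k \<omega>)))"
    by (intro Bochner_Integration.integral_cong) (simp_all add: step)
  also have "\<dots> = (\<Sum>i\<in>UNIV. L i powr \<alpha> / holder_sum L \<alpha>
      * expectation (\<lambda>\<omega>. f (rbcd_step P L \<nu> f i (X k \<omega>))))"
    using expectation_indep_selection[of "I k" "\<lambda>i x. f (rbcd_step P L \<nu> f i x)",
        OF J integrable_finite_range_compose[OF rv fin fs] sel]
    by (simp add: prob)
  also have "\<dots> \<le> (\<Sum>i\<in>UNIV. L i powr \<alpha> / holder_sum L \<alpha>
      * expectation (\<lambda>\<omega>. f (X k \<omega>) - c i * D i (X k \<omega>)))"
  proof (intro sum_mono mult_left_mono integral_mono)
    fix i \<omega>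
    show "f (rbcd_step P L \<nu> f i (X k \<omega>)) \<le> f (X k \<omega>) - c i * D i (X k \<omega>)"
      using rbcd_step_descent[OF P f g hol nu, of i "X k \<omega>"] by (simp add: c_def D_def)
  next
    fix i
    show "integrable M (\<lambda>\<omega>. f (rbcd_step P L \<nu> f i (X k \<omega>)))"
      by (intro integrable_finite_range_compose[OF rv fin fs])
  qed (use S int_f int_D in auto)
  also have "\<dots> = (\<Sum>i\<in>UNIV. L i powr \<alpha> / holder_sum L \<alpha> * expectation (\<lambda>\<omega>. f (X k \<omega>)))
      - (\<Sum>i\<in>UNIV. L i powr \<alpha> / holder_sum L \<alpha> * (c i * expectation (\<lambda>\<omega>. D i (X k \<omega>))))"
    using int_f int_D by (simp add: right_diff_distrib sum_subtractf)
  also have "(\<Sum>i\<in>UNIV. L i powr \<alpha> / holder_sum L \<alpha> * expectation (\<lambda>\<omega>. f (X k \<omega>)))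
      = expectation (\<lambda>\<omega>. f (X k \<omega>))"
    by (simp only: sum_distrib_right[symmetric] psum mult_1)
  also have "(\<Sum>i\<in>UNIV. L i powr \<alpha> / holder_sum L \<alpha> * (c i * expectation (\<lambda>\<omega>. D i (X k \<omega>))))
      = (\<Sum>i\<in>UNIV. L i powr (1 + \<alpha> - \<nu>) * expectation (\<lambda>\<omega>. D i (X k \<omega>))) / (\<nu> * holder_sum L \<alpha>)"
  proof -
    have "L i powr \<alpha> / holder_sum L \<alpha> * (c i * expectation (\<lambda>\<omega>. D i (X k \<omega>)))
      = L i powr (1 + \<alpha> - \<nu>) * expectation (\<lambda>\<omega>. D i (X k \<omega>)) / (\<nu> * holder_sum L \<alpha>)" for i
    proof -
      have "L i powr (1 + \<alpha> - \<nu>) = L i powr \<alpha> / L i powr (\<nu> - 1)"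
        by (simp add: powr_diff[symmetric] algebra_simps)
      then show ?thesis by (simp add: c_def)
    qed
    then show ?thesis by (simp add: sum_divide_distrib)
  qed
  also have "(\<Sum>i\<in>UNIV. L i powr (1 + \<alpha> - \<nu>) * expectation (\<lambda>\<omega>. D i (X k \<omega>)))
      = expectation (\<lambda>\<omega>. \<Sum>i\<in>UNIV. L i powr (1 + \<alpha> - \<nu>) * D i (X k \<omega>))"
    using int_D by simp
  also have "\<dots> = expectation (\<lambda>\<omega>. block_norm P L (1 + \<alpha> - \<nu>) \<nu> (gradient f (X k \<omega>)) powr \<nu>)"
    using nu1 by (simp add: block_norm_powr D_def block_gradient_def)
  finally show ?thesis .
qed

theorem theorem4p4p2:
  fixes f :: "real ^ 'd \<Rightarrow> real"
    and P :: "'m::finite \<Rightarrow> real ^ 'd ^ 'd"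
    and L :: "'m \<Rightarrow> real"
    and M :: "'w measure"
    and I :: "nat \<Rightarrow> 'w \<Rightarrow> 'm"
    and X :: "nat \<Rightarrow> 'w \<Rightarrow> real ^ 'd"
    and \<alpha> \<beta> \<gamma> \<nu> fstar :: real
  assumes "block_projections P"
    and "continuously_differentiable f"
    and "\<exists>x. f x = fstar" and "\<forall>x. fstar \<le> f x"
    and "0 < \<gamma>" and "\<gamma> \<le> 1"
    and "holder_smooth \<gamma> f"
    and "block_holder_smooth P \<gamma> L f"
    and "\<nu> = (1 + \<gamma>) / \<gamma>"
    and "0 \<le> \<alpha>" and "\<alpha> \<le> 1"
    and "rbcd M P L \<alpha> \<nu> f x0 I X"
  shows
    "(\<forall>k::nat.
        Min ((\<lambda>j. integral\<^sup>L M (\<lambda>\<omega>. block_norm P L (1 + \<alpha> - \<nu>) \<nu> (gradient f (X j \<omega>)))) ` {0..k})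
          \<le> (\<nu> * holder_sum L \<alpha>) powr (1 / \<nu>)
             * ((f x0 - fstar) / (real k + 1)) powr (1 / \<nu>)) \<and>
     (\<lambda>k::nat. (\<nu> * holder_sum L \<alpha>) powr (1 / \<nu>)
             * ((f x0 - fstar) / (real k + 1)) powr (1 / \<nu>))
        \<in> O(\<lambda>k. real k powr (- (1 / \<nu>))) \<and>
     (\<forall>k::nat.
        Min ((\<lambda>j. integral\<^sup>L M (\<lambda>\<omega>. block_norm P L \<beta> 2 (gradient f (X j \<omega>)))) ` {0..k})
          \<le> (Max (range (\<lambda>i. L i powr (\<beta> / 2 - (1 + \<alpha> - \<nu>) / \<nu>)))
               * real CARD('m) powr ((\<nu> - 2) / (2 * \<nu>)))
             * (\<nu> * holder_sum L \<alpha>) powr (1 / \<nu>)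
             * ((f x0 - fstar) / (real k + 1)) powr (1 / \<nu>)) \<and>
     (\<lambda>k::nat. (Max (range (\<lambda>i. L i powr (\<beta> / 2 - (1 + \<alpha> - \<nu>) / \<nu>)))
               * real CARD('m) powr ((\<nu> - 2) / (2 * \<nu>)))
             * (\<nu> * holder_sum L \<alpha>) powr (1 / \<nu>)
             * ((f x0 - fstar) / (real k + 1)) powr (1 / \<nu>))
        \<in> O(\<lambda>k. real k powr (- (1 / \<nu>)))"
proof -
  note P = \<open>block_projections P\<close> and f = \<open>continuously_differentiable f\<close>
    and hol = \<open>block_holder_smooth P \<gamma> L f\<close> and rbcd = \<open>rbcd M P L \<alpha> \<nu> f x0 I X\<close>
    and nu = \<open>\<nu> = (1 + \<gamma>) / \<gamma>\<close> and g = \<open>0 < \<gamma>\<close>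
  interpret prob_space M using rbcd by (simp add: rbcd_def)
  have init: "\<And>\<omega>. \<omega> \<in> space M \<Longrightarrow> X 0 \<omega> = x0"
    and step: "\<And>k \<omega>. \<omega> \<in> space M \<Longrightarrow> X (Suc k) \<omega> = rbcd_step P L \<nu> f (I k \<omega>) (X k \<omega>)"
    and ind: "indep_vars (\<lambda>_. count_space UNIV) I UNIV"
    using rbcd by (auto simp: rbcd_def)
  have Lp: "L i > 0" for i using hol by (auto simp: block_holder_smooth_def)
  define S where "S = holder_sum L \<alpha>"
  have S: "S > 0"
    unfolding S_def holder_sum_def by (intro sum_pos) (auto simp: Lp[THEN less_imp_neq, symmetric])
  \<comment> \<open>This is where \<open>\<gamma> \<le> 1\<close> enters: the comparison with
    exponent \<open>2\<close> needs \<open>\<nu>\<close> to be at least \<open>2\<close>.\<close>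
  have nu2: "\<nu> \<ge> 2" using g \<open>\<gamma> \<le> 1\<close> by (simp add: nu field_simps)
  define \<Delta> where "\<Delta> = f x0 - fstar"
  have Delta: "\<Delta> \<ge> 0" using \<open>\<forall>x. fstar \<le> f x\<close> by (simp add: \<Delta>_def)
  define N where "N x = block_norm P L (1 + \<alpha> - \<nu>) \<nu> (gradient f x)" for x
  define N2 where "N2 x = block_norm P L \<beta> 2 (gradient f x)" for x
  \<comment> \<open>The power of the number of blocks multiplies the maximum, whereas the statement
    in words divides by it. The factor comes from \<open>L2_sum_le_Lp_sum\<close>; the two forms
    agree for one block or for \<open>\<nu> = 2\<close>.\<close>
  define W where "W = Max (range (\<lambda>i. L i powr (\<beta> / 2 - (1 + \<alpha> - \<nu>) / \<nu>)))
    * real CARD('m) powr ((\<nu> - 2) / (2 * \<nu>))"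
  define B where "B k = (\<nu> * S) powr (1 / \<nu>) * (\<Delta> / (real k + 1)) powr (1 / \<nu>)" for k :: nat
  have rv: "random_variable borel (X k)" for k
    using ind init step borel_measurable_rbcd_step[OF f] by (rule random_variable_random_recursion)
  have fin: "finite (X k ` space M)" for k
    using init step by (rule finite_range_random_recursion)
  have Nm [measurable]: "N \<in> borel_measurable borel" "N2 \<in> borel_measurable borel"
    unfolding N_def[abs_def] N2_def[abs_def] by (intro borel_measurable_block_norm_gradient f)+
  note fm = borel_measurable_of_continuously_differentiable[OF f]
  have int: "integrable M (\<lambda>\<omega>. u (X k \<omega>))" if "u \<in> borel_measurable borel"
    for u :: "real ^ 'd \<Rightarrow> real" and k
    using integrable_finite_range_compose[OF rv fin that] .
  have N0: "N x \<ge> 0" "N2 x \<ge> 0" for x by (simp_all add: N_def N2_def block_norm_def)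
  define e where "e j = expectation (\<lambda>\<omega>. N (X j \<omega>))" for j
  define e2 where "e2 j = expectation (\<lambda>\<omega>. N2 (X j \<omega>))" for j
  define \<Phi> where "\<Phi> j = expectation (\<lambda>\<omega>. f (X j \<omega>))" for j
  have e0: "e j \<ge> 0" for j
    unfolding e_def using N0 by simp
  \<comment> \<open>Jensen's inequality, then the expected decrease solved for the gradient
    term.\<close>
  have "e j powr \<nu> \<le> \<nu> * S * (\<Phi> j - \<Phi> (Suc j))" for j
  proof -
    have "e j powr \<nu> \<le> expectation (\<lambda>\<omega>. N (X j \<omega>) powr \<nu>)"
      unfolding e_def using nu2 N0 int[of N] int[of "\<lambda>x. N x powr \<nu>"]
      by (intro expectation_powr_le) auto
    also have "\<dots> \<le> \<nu> * S * (\<Phi> j - \<Phi> (Suc j))"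
      using rbcd_expected_descent[OF P f g hol nu rbcd, of j] S nu2
      by (simp add: \<Phi>_def N_def S_def field_simps)
    finally show ?thesis .
  qed
  then have "(\<Sum>j\<le>k. e j powr \<nu>) \<le> (\<Sum>j\<le>k. \<nu> * S * (\<Phi> j - \<Phi> (Suc j)))" for k
    by (intro sum_mono)
  \<comment> \<open>The \<open>k + 1\<close> differences telescope; the start is deterministic, so
    \<open>\<Phi> 0 = f x0\<close>, and \<open>\<Phi> (Suc k)\<close> is at least
    \<open>fstar\<close>.\<close>
  also have "(\<Sum>j\<le>k. \<nu> * S * (\<Phi> j - \<Phi> (Suc j))) = \<nu> * S * (\<Phi> 0 - \<Phi> (Suc k))" for k
    by (simp add: sum_distrib_left[symmetric] sum_telescope)
  also have "\<nu> * S * (\<Phi> 0 - \<Phi> (Suc k)) \<le> \<nu> * S * \<Delta>" for k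
  proof -
    have "\<Phi> 0 = expectation (\<lambda>_. f x0)"
      unfolding \<Phi>_def by (intro Bochner_Integration.integral_cong) (simp_all add: init)
    then have "\<Phi> 0 = f x0" by (simp add: prob_space)
    moreover have "expectation (\<lambda>_. fstar) \<le> \<Phi> (Suc k)"
      unfolding \<Phi>_def using \<open>\<forall>x. fstar \<le> f x\<close> int[OF fm] by (intro integral_mono) auto
    ultimately show ?thesis
      using S nu2 by (intro mult_left_mono) (auto simp: \<Delta>_def prob_space)
  qed
  finally have bound: "Min (e ` {0..k}) \<le> B k" for k
    using min_le_of_sum_powr_le[of \<nu> e k "\<nu> * S * \<Delta>"] nu2 e0 S Delta
    by (simp add: B_def powr_mult flip: times_divide_eq_right)
  have W0: "W \<ge> 0"
  proof -
    \<comment> \<open>\<open>undefined\<close> serves as an arbitrary index, since the index type is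
      inhabited.\<close>
    have "0 \<le> L undefined powr (\<beta> / 2 - (1 + \<alpha> - \<nu>) / \<nu>)" by simp
    also have "\<dots> \<le> Max (range (\<lambda>i. L i powr (\<beta> / 2 - (1 + \<alpha> - \<nu>) / \<nu>)))"
      by (intro Max_ge) auto
    finally show ?thesis by (simp add: W_def)
  qed
  have e2e: "e2 j \<le> W * e j" for j
  proof -
    have "e2 j \<le> expectation (\<lambda>\<omega>. W * N (X j \<omega>))"
      unfolding e2_def N2_def N_def W_def
      using int[OF Nm(1)] int[OF Nm(2)] Lp nu2
      by (intro integral_mono block_norm_le_block_norm) (auto simp: N_def N2_def)
    then show ?thesis by (simp add: e_def)
  qed
  have bound2: "Min (e2 ` {0..k}) \<le> W * B k" for k
  proof -
    \<comment> \<open>An index that attains the first minimum is a competitor for the second one, so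
      the norm comparison at this single iterate suffices.\<close>
    have "Min (e ` {0..k}) \<in> e ` {0..k}" by (intro Min_in) auto
    then obtain j where j: "j \<in> {0..k}" "e j = Min (e ` {0..k})" by force
    have "Min (e2 ` {0..k}) \<le> e2 j" using j by (intro Min_le) auto
    also have "\<dots> \<le> W * e j" by (rule e2e)
    also have "\<dots> \<le> W * B k" using bound[of k] W0 j by (intro mult_left_mono) auto
    finally show ?thesis .
  qed
  have "B \<in> O(\<lambda>k. real k powr (- (1 / \<nu>)))" "(\<lambda>k. W * B k) \<in> O(\<lambda>k. real k powr (- (1 / \<nu>)))"
    unfolding B_def[abs_def] mult.assoc[symmetric] using nu2 Delta
    by (intro powr_decay_bigo; simp)+
  with bound bound2 show ?thesis
    by (simp add: e_def e2_def N_def N2_def W_def B_def[abs_def] S_def \<Delta>_def mult.assoc)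
qed

end
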